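(* Let $\mathcal{G}$ be an undirected graph with $n\geq d+1$ vertices. If $(\mathcal{G},p)$ is weakly rigid for some generic configuration $p\in\mathbb{R}^{nd}$, then $\mathcal{G}$ is generically weakly rigid in $\mathbb{R}^d$.
   Context: Graphs $\mathcal{G}=(\mathcal{V},\mathcal{E})$ are finite, simple and undirected, $\mathcal{V}=\{1,\dots,n\}$, and $(i,j)$, $(j,i)$ denote the same edge. A framework $(\mathcal{G},p)$ in $\mathbb{R}^d$ is a graph with a configuration $p=(p_1^T,\dots,p_n^T)^T\in\mathbb{R}^{nd}$. Let $\mathcal{T}_\mathcal{G}=\{(i,j,k)\in\mathcal{V}^3:(i,j),(i,k)\in\mathcal{E},\ j\leq k\}$. For $\mathcal{T}_\mathcal{G}^*\subseteq\mathcal{T}_\mathcal{G}$, $(\mathcal{G},p)$ and $(\mathcal{G},q)$ are weakly equivalent for $\mathcal{T}_\mathcal{G}^*$ if $(p_i-p_j)^T(p_i-p_k)=(q_i-q_j)^T(q_i-q_k)$ for all $(i,j,k)\in\mathcal{T}_\mathcal{G}^*$, and weakly congruent if this holds for all $i,j,k\in\mathcal{V}$. $(\mathcal{G},p)$ is weakly rigid if for some $\mathcal{T}_\mathcal{G}^*\subseteq\mathcal{T}_\mathcal{G}$ there is a neighborhood $U_p$ of $p$ such that for every $q\in U_p$, if $(\mathcal{G},p)$ and $(\mathcal{G},q)$ are weakly equivalent for $\mathcal{T}_\mathcal{G}^*$, then they are weakly congruent. A configuration $p\in\mathbb{R}^{nd}$ is generic if its $nd$ coordinates are algebraically independent over the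 integers, i.e. there is no nonzero polynomial with integer coefficients in $nd$ variables vanishing at the coordinates of $p$. The graph $\mathcal{G}$ is generically weakly rigid in $\mathbb{R}^d$ if for every generic configuration $q\in\mathbb{R}^{nd}$ the framework $(\mathcal{G},q)$ is weakly rigid. *)

theory Defs
  imports "HOL-Analysis.Analysis" "HOL-Library.Poly_Mapping"
begin

text \<open>
  The vertices \<open>1, \<dots>, n\<close> are the elements of a finite linearly ordered type \<open>'n\<close>, so
  \<open>n = CARD('n)\<close>; likewise \<open>d = CARD('d)\<close>. A configuration is an element \<open>p\<close> of
  \<^typ>\<open>real ^ 'd ^ 'n\<close>, with \<open>p $ i\<close> the position of vertex \<open>i\<close>.
  An edge set is a relation on the vertices; that an undirected edge is both
  \<open>(i, j)\<close> and \<open>(j, i)\<close> is expressed by symmetry.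
\<close>

definition simple_graph :: "('n \<times> 'n) set \<Rightarrow> bool" where
  "simple_graph E \<longleftrightarrow> sym E \<and> irrefl E"

definition angle_triples :: "('n::linorder \<times> 'n) set \<Rightarrow> ('n \<times> 'n \<times> 'n) set" where
  "angle_triples E = {(i, j, k). (i, j) \<in> E \<and> (i, k) \<in> E \<and> j \<le> k}"

definition weakly_equivalent ::
    "('n \<times> 'n \<times> 'n) set \<Rightarrow> real ^ 'd::finite ^ 'n::finite \<Rightarrow> real ^ 'd ^ 'n \<Rightarrow> bool" where
  "weakly_equivalent T p q \<longleftrightarrow>
     (\<forall>(i, j, k)\<in>T. (p $ i - p $ j) \<bullet> (p $ i - p $ k) = (q $ i - q $ j) \<bullet> (q $ i - q $ k))"

definition weakly_congruent ::
    "real ^ 'd::finite ^ 'n::finite \<Rightarrow> real ^ 'd ^ 'n \<Rightarrow> bool" where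
  "weakly_congruent p q \<longleftrightarrow>
     (\<forall>i j k. (p $ i - p $ j) \<bullet> (p $ i - p $ k) = (q $ i - q $ j) \<bullet> (q $ i - q $ k))"

definition weakly_rigid ::
    "('n \<times> 'n) set \<Rightarrow> real ^ 'd::finite ^ 'n::{finite,linorder} \<Rightarrow> bool" where
  "weakly_rigid E p \<longleftrightarrow>
     (\<exists>T \<subseteq> angle_triples E. \<exists>U. open U \<and> p \<in> U \<and>
        (\<forall>q\<in>U. weakly_equivalent T p q \<longrightarrow> weakly_congruent p q))"

text \<open>
  Integer polynomials in variables indexed by a finite type \<open>'v\<close> are finitely supported maps
  from monomials to coefficients, a monomial being the map of its exponents.
\<close>

definition eval_int_poly :: "('v::finite \<Rightarrow> real) \<Rightarrow> (('v \<Rightarrow>\<^sub>0 nat) \<Rightarrow>\<^sub>0 int) \<Rightarrow> real" where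
  "eval_int_poly x P =
     (\<Sum>m\<in>Poly_Mapping.keys P.
        of_int (Poly_Mapping.lookup P m) * (\<Prod>v\<in>UNIV. x v ^ Poly_Mapping.lookup m v))"

definition algebraically_independent_int :: "('v::finite \<Rightarrow> real) \<Rightarrow> bool" where
  "algebraically_independent_int x \<longleftrightarrow>
     \<not> (\<exists>P. P \<noteq> 0 \<and> eval_int_poly x P = 0)"

definition generic_configuration :: "real ^ 'd::finite ^ 'n::finite \<Rightarrow> bool" where
  "generic_configuration p \<longleftrightarrow>
     algebraically_independent_int (\<lambda>(i, a). p $ i $ a)"

definition generically_weakly_rigid ::
    "'d::finite itself \<Rightarrow> ('n::{finite,linorder} \<times> 'n) set \<Rightarrow> bool" where
  "generically_weakly_rigid _ E \<longleftrightarrow>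
     (\<forall>q :: real ^ 'd ^ 'n::{finite,linorder}. generic_configuration q \<longrightarrow> weakly_rigid E q)"

end

theory Submission
  imports Defs
begin

text \<open>
  Let \<open>f\<close> collect the products \<open>(p\<^sub>i - p\<^sub>j) \<bullet> (p\<^sub>i - p\<^sub>k)\<close> over the triples of the graph and \<open>h\<close>
  those over all triples. The dimension of the kernel of the derivative of either map is at its
  minimum at a generic configuration, since that minimum is witnessed by the nonvanishing of an integer
  polynomial; so it is the same at all generic configurations and locally constant there.
  By the constant rank theorem the level sets of \<open>f\<close> near a generic \<open>p\<close> are manifolds tangent to
  the kernels of \<open>f'\<close>, so weak rigidity at \<open>p\<close> means that the kernels of \<open>f'\<close> and \<open>h'\<close> have
  the same dimension, a condition independent of \<open>p\<close>.
\<close>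

section \<open>Linear algebra: separating coordinates and Gram determinants\<close>

text \<open>A basis \<open>B\<close> of the orthogonal complement \<open>W\<close> of
  \<open>V\<close> extends by standard basis vectors to a basis \<open>C\<close> of the whole space.
  The added vectors number \<open>dim V\<close>, and a vector of \<open>V\<close> orthogonal to them
  is orthogonal to all of \<open>C\<close>, hence to itself.\<close>

lemma coordinates_separating_subspace:
  fixes V :: "'a::euclidean_space set"
  assumes "subspace V"
  obtains D where "D \<subseteq> Basis" "card D = dim V"
    "\<forall>v\<in>V. (\<forall>b\<in>D. v \<bullet> b = 0) \<longrightarrow> v = 0"
proof -
  define W where "W = {y \<in> UNIV. \<forall>x\<in>V. orthogonal x y}"
  have dimW: "dim W + dim V = DIM('a)"
    using dim_subspace_orthogonal_to_vectors[OF assms subspace_UNIV] by (simp add: W_def)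
  obtain B where B: "B \<subseteq> W" "independent B" "W \<subseteq> span B" "card B = dim W"
    using basis_exists by blast
  obtain C where C: "B \<subseteq> C" "C \<subseteq> B \<union> Basis" "independent C" "B \<union> Basis \<subseteq> span C"
    using maximal_independent_subset_extend[of B "B \<union> Basis"] B(2) by blast
  have spanC: "span C = UNIV"
    using C(4) by (metis le_sup_iff span_Basis span_mono span_span top.extremum_uniqueI)
  have cardC: "card C = DIM('a)"
    using C(3) spanC by (metis dim_UNIV dim_eq_card_independent dim_span)
  show ?thesis
  proof
    show "C - B \<subseteq> Basis" using C(2) by blast
    show "card (C - B) = dim V"
      using cardC dimW B(4) card_Diff_subset[OF independent_imp_finite[OF B(2)] C(1)] by simp
    have "v = 0" if v: "v \<in> V" "\<forall>b\<in>C - B. v \<bullet> b = 0" for v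
    proof -
      have "orthogonal v c" if "c \<in> C" for c
        using that v B(1) unfolding W_def orthogonal_def by (cases "c \<in> B") auto
      then have "orthogonal v v"
        by (metis UNIV_I orthogonal_to_span spanC)
      then show ?thesis by (simp add: orthogonal_def)
    qed
    then show "\<forall>v\<in>V. (\<forall>b\<in>C - B. v \<bullet> b = 0) \<longrightarrow> v = 0" by blast
  qed
qed

text \<open>The projection \<open>g\<close> onto the coordinates in \<open>D\<close> is injective on
  \<open>V\<close> and has its image in the span of \<open>D\<close>.\<close>

lemma dim_le_card_separating_coordinates:
  fixes V :: "'a::euclidean_space set"
  assumes "subspace V" "D \<subseteq> Basis"
    and sep: "\<And>v. v \<in> V \<Longrightarrow> (\<And>b. b \<in> D \<Longrightarrow> v \<bullet> b = 0) \<Longrightarrow> v = 0"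
  shows "dim V \<le> card D"
proof -
  define g where "g v = (\<Sum>b\<in>D. (v \<bullet> b) *\<^sub>R b)" for v :: 'a
  have fin: "finite D" using assms(2) finite_Basis finite_subset by blast
  have lin: "linear g"
    unfolding g_def by (intro linear_compose_sum ballI linearI) (auto simp: inner_add_left scaleR_add_left)
  have coord: "g v \<bullet> b = v \<bullet> b" if "b \<in> D" for v b
  proof -
    have "g v \<bullet> b = (\<Sum>c\<in>D. if c = b then v \<bullet> b else 0)"
      unfolding g_def inner_sum_left
      by (rule sum.cong) (use that assms(2) in \<open>auto simp: inner_Basis subset_iff\<close>)
    then show ?thesis using that fin by simp
  qed
  have "inj_on g (span V)"
    unfolding span_eq_iff[THEN iffD2, OF assms(1)] linear_inj_on_iff_eq_0[OF lin assms(1)]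
    using coord sep by (metis inner_zero_left)
  then have "dim V = dim (g ` V)" using dim_image_eq[OF lin] by metis
  also have "\<dots> \<le> card D"
    unfolding g_def
    by (rule dim_le_card[OF _ fin], rule image_subsetI, rule span_sum, rule span_scale, rule span_base)
  finally show ?thesis .
qed

text \<open>With \<open>G\<close> the Gram matrix and \<open>s\<close> the linear combination of the
  \<open>u a\<close> with coefficients \<open>c\<close>, one has
  \<open>c \<bullet> G c = s \<bullet> s\<close>. So the kernel of \<open>G\<close> consists exactly
  of the linear relations among the \<open>u a\<close>.\<close>

lemma det_gram_nonzero_iff:
  fixes u :: "'k::finite \<Rightarrow> 'b::real_inner"
  shows "det (\<chi> a b. u a \<bullet> u b) \<noteq> 0 \<longleftrightarrow> (\<forall>c::real^'k. (\<Sum>a\<in>UNIV. c $ a *\<^sub>R u a) = 0 \<longrightarrow> c = 0)"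
proof -
  let ?G = "(\<chi> a b. u a \<bullet> u b) :: real^'k^'k"
  let ?s = "\<lambda>c::real^'k. \<Sum>a\<in>UNIV. c $ a *\<^sub>R u a"
  have row: "(?G *v c) $ a = u a \<bullet> ?s c" for c a
    by (simp add: matrix_vector_mult_def inner_sum_right mult.commute)
  have "c \<bullet> (?G *v c) = ?s c \<bullet> ?s c" for c
    by (subst inner_sum_left) (simp add: inner_vec_def[of c] row)
  then have "?G *v c = 0 \<longleftrightarrow> ?s c = 0" for c
    by (metis (no_types, lifting) inner_eq_zero_iff inner_zero_right row vec_eq_iff zero_index)
  then have "(\<forall>c. ?G *v c = 0 \<longrightarrow> c = 0) \<longleftrightarrow> (\<forall>c. ?s c = 0 \<longrightarrow> c = 0)"
    by blast
  then show ?thesis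
    unfolding invertible_det_nz[symmetric] invertible_left_inverse matrix_left_invertible_ker .
qed

section \<open>Integer polynomial functions\<close>

text \<open>This allows a common index set for several polynomials, whose sets of monomials differ
  and may shrink by cancellation in a sum.\<close>

lemma eval_int_poly_superset:
  assumes "finite K" "Poly_Mapping.keys P \<subseteq> K"
  shows "eval_int_poly x P =
    (\<Sum>m\<in>K. of_int (Poly_Mapping.lookup P m) * (\<Prod>v\<in>UNIV. x v ^ Poly_Mapping.lookup m v))"
  unfolding eval_int_poly_def using assms
  by (intro sum.mono_neutral_left) (auto simp: in_keys_iff)

lemma eval_int_poly_zero [simp]: "eval_int_poly x 0 = 0"
  by (simp add: eval_int_poly_def)

lemma eval_int_poly_add: "eval_int_poly x (P + Q) = eval_int_poly x P + eval_int_poly x Q"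
proof -
  let ?K = "Poly_Mapping.keys P \<union> Poly_Mapping.keys Q"
  have K: "finite ?K" by simp
  show ?thesis
    by (simp add: eval_int_poly_superset[OF K] Poly_Mapping.keys_add lookup_add
        sum.distrib distrib_right)
qed

lemma eval_int_poly_sum: "eval_int_poly x (\<Sum>i\<in>I. P i) = (\<Sum>i\<in>I. eval_int_poly x (P i))"
  by (induction I rule: infinite_finite_induct) (auto simp: eval_int_poly_add)

lemma eval_int_poly_single:
  "eval_int_poly x (Poly_Mapping.single m c) = of_int c * (\<Prod>v\<in>UNIV. x v ^ Poly_Mapping.lookup m v)"
  by (simp add: eval_int_poly_superset[of "{m}"])

lemma sum_single_lookup:
  "(\<Sum>m\<in>Poly_Mapping.keys P. Poly_Mapping.single m (Poly_Mapping.lookup P m)) = P"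
  by (rule poly_mapping_eqI) (auto simp: lookup_sum lookup_single when_def in_keys_iff)

text \<open>Expanding both factors into monomials reduces the claim to the rule that exponents
  add.\<close>

lemma eval_int_poly_mult: "eval_int_poly x (P * Q) = eval_int_poly x P * eval_int_poly x Q"
proof -
  let ?s = "\<lambda>P m. Poly_Mapping.single m (Poly_Mapping.lookup P m)"
  have "eval_int_poly x (P * Q) =
    eval_int_poly x ((\<Sum>m\<in>Poly_Mapping.keys P. ?s P m) * (\<Sum>m\<in>Poly_Mapping.keys Q. ?s Q m))"
    by (simp only: sum_single_lookup)
  also have "\<dots> = eval_int_poly x P * eval_int_poly x Q"
    by (simp add: sum_product eval_int_poly_sum mult_single eval_int_poly_single lookup_add
        power_add prod.distrib eval_int_poly_def[of x P] eval_int_poly_def[of x Q] mult.assoc mult.left_commute)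
  finally show ?thesis .
qed

text \<open>Working with functions instead of explicit polynomials lets closure rules show that a
  Gram determinant is an integer polynomial.\<close>

definition int_poly_fun :: "(real ^ 'd::finite ^ 'n::finite \<Rightarrow> real) \<Rightarrow> bool" where
  "int_poly_fun g \<longleftrightarrow> (\<exists>P. \<forall>x. g x = eval_int_poly (\<lambda>(i, a). x $ i $ a) P)"

lemma int_poly_fun_const: "int_poly_fun (\<lambda>x. of_int c)"
  unfolding int_poly_fun_def
  by (rule exI[of _ "Poly_Mapping.single 0 c"]) (simp add: eval_int_poly_single)

lemma int_poly_fun_coord: "int_poly_fun (\<lambda>x :: real ^ 'd::finite ^ 'n::finite. x $ i $ a)"
proof -
  have "(\<Prod>v\<in>UNIV. (case v of (j, b) \<Rightarrow> x $ j $ b) ^ Poly_Mapping.lookup (Poly_Mapping.single (i, a) 1) v)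
      = x $ i $ a" for x :: "real ^ 'd ^ 'n"
  proof -
    have "(\<Prod>v\<in>UNIV. (case v of (j, b) \<Rightarrow> x $ j $ b) ^ Poly_Mapping.lookup (Poly_Mapping.single (i, a) 1) v)
      = (\<Prod>v\<in>UNIV. if (i, a) = v then x $ i $ a else 1)"
      by (rule prod.cong) (auto simp: lookup_single when_def)
    then show ?thesis by simp
  qed
  then show ?thesis
    unfolding int_poly_fun_def
    by (intro exI[of _ "Poly_Mapping.single (Poly_Mapping.single (i, a) 1) 1"])
      (simp add: eval_int_poly_single)
qed

lemma int_poly_fun_add:
  assumes "int_poly_fun g" "int_poly_fun h"
  shows "int_poly_fun (\<lambda>x. g x + h x)"
  using assms unfolding int_poly_fun_def by (metis eval_int_poly_add)

lemma int_poly_fun_mult: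
  assumes "int_poly_fun g" "int_poly_fun h"
  shows "int_poly_fun (\<lambda>x. g x * h x)"
  using assms unfolding int_poly_fun_def by (metis eval_int_poly_mult)

lemma int_poly_fun_diff:
  assumes "int_poly_fun g" "int_poly_fun h"
  shows "int_poly_fun (\<lambda>x. g x - h x)"
  using int_poly_fun_add[OF assms(1) int_poly_fun_mult[OF int_poly_fun_const[of "-1"] assms(2)]] by simp

lemma int_poly_fun_sum:
  assumes "\<And>i. i \<in> I \<Longrightarrow> int_poly_fun (g i)"
  shows "int_poly_fun (\<lambda>x. \<Sum>i\<in>I. g i x)"
  using assms
  by (induction I rule: infinite_finite_induct)
    (auto intro: int_poly_fun_add simp: int_poly_fun_const[of 0, simplified])

lemma int_poly_fun_prod:
  assumes "\<And>i. i \<in> I \<Longrightarrow> int_poly_fun (g i)"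
  shows "int_poly_fun (\<lambda>x. \<Prod>i\<in>I. g i x)"
  using assms
  by (induction I rule: infinite_finite_induct)
    (auto intro: int_poly_fun_mult simp: int_poly_fun_const[of 1, simplified])

lemma int_poly_fun_det:
  fixes M :: "real ^ 'd::finite ^ 'n::finite \<Rightarrow> real ^ 'k::finite ^ 'k"
  assumes "\<And>a b. int_poly_fun (\<lambda>x. M x $ a $ b)"
  shows "int_poly_fun (\<lambda>x. det (M x))"
  unfolding det_def
  by (intro int_poly_fun_sum int_poly_fun_mult int_poly_fun_const int_poly_fun_prod assms)

lemma continuous_int_poly_fun:
  assumes "int_poly_fun g"
  shows "isCont g x"
proof -
  obtain P where P: "g = (\<lambda>x. eval_int_poly (\<lambda>(i, a). x $ i $ a) P)"
    using assms unfolding int_poly_fun_def by blast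
  show ?thesis
    unfolding P eval_int_poly_def case_prod_unfold by (intro continuous_intros)
qed

text \<open>The arbitrary point \<open>x\<close> serves only to show that the polynomial
  representing \<open>g\<close> is not the zero polynomial; algebraic independence then excludes
  \<open>p\<close> as a root.\<close>

lemma generic_int_poly_fun_nonzero:
  assumes "generic_configuration p" "int_poly_fun g" "g x \<noteq> 0"
  shows "g p \<noteq> 0"
  using assms unfolding generic_configuration_def algebraically_independent_int_def int_poly_fun_def
  by (metis eval_int_poly_zero)

section \<open>Kernel dimensions at generic configurations\<close>

text \<open>
  If the coordinates in \<open>D\<close> separate the kernel at \<open>x\<close>, and \<open>\<pi>\<close> projects onto them, then
  \<open>v \<mapsto> (f' x v, \<pi> v)\<close> is injective. The injectivity of this map at \<open>y\<close> is the nonvanishing of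
  its Gram determinant, an integer polynomial in \<open>y\<close>.
\<close>

lemma generic_kernel_dim_le:
  fixes f' :: "real ^ 'd::finite ^ 'n::finite \<Rightarrow> (real ^ 'd ^ 'n) \<Rightarrow>\<^sub>L 'b::euclidean_space"
  assumes p: "generic_configuration p"
    and poly: "\<And>i a j b. int_poly_fun (\<lambda>x. f' x (axis i (axis a 1)) \<bullet> f' x (axis j (axis b 1)))"
  shows "\<forall>\<^sub>F y in nhds p. dim {v. f' y v = 0} \<le> dim {v. f' x v = 0}"
proof -
  have sub: "subspace {v. f' y v = 0}" for y
    by (auto simp: subspace_def blinfun.bilinear_simps)
  obtain D where D: "D \<subseteq> Basis" "card D = dim {v. f' x v = 0}"
    and sep: "\<forall>v\<in>{v. f' x v = 0}. (\<forall>b\<in>D. v \<bullet> b = 0) \<longrightarrow> v = 0"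
    using coordinates_separating_subspace[OF sub[of x]] by blast
  have fin: "finite D" using D(1) finite_Basis finite_subset by blast
  define e where "e = (\<lambda>(i, a). axis i (axis a 1) :: real ^ 'd ^ 'n)"
  define \<pi> where "\<pi> v = (\<Sum>b\<in>D. (v \<bullet> b) *\<^sub>R b)" for v :: "real ^ 'd ^ 'n"
  have pi_coord: "\<pi> v \<bullet> b = (if b \<in> D then v \<bullet> b else 0)" if "b \<in> Basis" for v b
  proof -
    have "\<pi> v \<bullet> b = (\<Sum>c\<in>D. if c = b then v \<bullet> b else 0)"
      unfolding \<pi>_def inner_sum_left
      by (rule sum.cong) (use that D(1) in \<open>auto simp: inner_Basis subset_iff\<close>)
    then show ?thesis using fin by simp
  qed
  have linpi: "linear \<pi>"
    unfolding \<pi>_def by (intro linear_compose_sum ballI linearI) (auto simp: inner_add_left scaleR_add_left)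
  have pi0: "\<pi> v = 0 \<longleftrightarrow> (\<forall>b\<in>D. v \<bullet> b = 0)" for v
    using D(1) pi_coord[of _ v] by (auto simp: euclidean_eq_iff[of "\<pi> v"])
  define u where "u y \<alpha> = (f' y (e \<alpha>), \<pi> (e \<alpha>))" for y \<alpha>
  define g where "g y = det (\<chi> \<alpha> \<beta>. u y \<alpha> \<bullet> u y \<beta>)" for y
  have eB: "e \<alpha> \<in> Basis" for \<alpha>
    by (auto simp: e_def Basis_vec_def split: prod.split)
  have "int_poly_fun (\<lambda>y. u y \<alpha> \<bullet> u y \<beta>)" for \<alpha> \<beta>
  proof -
    \<comment> \<open>The projection contributes only entries 0 and 1 to the Gram matrix, so the
      coefficients remain integers.\<close>
    have "\<pi> (e \<alpha>) \<bullet> \<pi> (e \<beta>) = of_int (\<Sum>b\<in>D. if b = e \<alpha> \<and> b = e \<beta> then 1 else 0)"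
      unfolding \<pi>_def[of "e \<alpha>"] inner_sum_left of_int_sum
      by (rule sum.cong)
        (use D(1) in \<open>auto simp: inner_commute[of _ "\<pi> _"] pi_coord subset_iff inner_Basis eB\<close>)
    moreover have "int_poly_fun (\<lambda>y. f' y (e \<alpha>) \<bullet> f' y (e \<beta>))"
      using poly by (simp add: e_def split: prod.split)
    ultimately show ?thesis
      unfolding u_def inner_prod_def fst_conv snd_conv by (simp only: int_poly_fun_add int_poly_fun_const)
  qed
  then have gpoly: "int_poly_fun g"
    unfolding g_def by (intro int_poly_fun_det) simp
  have expand: "v = (\<Sum>\<alpha>\<in>UNIV. (v $ fst \<alpha> $ snd \<alpha>) *\<^sub>R e \<alpha>)" for v :: "real ^ 'd ^ 'n"
  proof -
    have "(\<Sum>\<alpha>\<in>UNIV. (v $ fst \<alpha> $ snd \<alpha>) *\<^sub>R e \<alpha>) $ j $ b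
      = (\<Sum>\<alpha>\<in>UNIV. if \<alpha> = (j, b) then v $ j $ b else 0)" for j b
      unfolding sum_component
      by (rule sum.cong) (auto simp: e_def axis_def split: prod.split)
    then show ?thesis by (simp add: vec_eq_iff)
  qed
  have u_sum: "(\<Sum>\<alpha>\<in>UNIV. c \<alpha> *\<^sub>R u y \<alpha>)
      = (f' y (\<Sum>\<alpha>\<in>UNIV. c \<alpha> *\<^sub>R e \<alpha>), \<pi> (\<Sum>\<alpha>\<in>UNIV. c \<alpha> *\<^sub>R e \<alpha>))" for c y
    by (simp add: u_def prod_eq_iff fst_sum snd_sum blinfun.sum_right blinfun.scaleR_right
        linear_sum[OF linpi] linear_scale[OF linpi])
  have comb: "(\<Sum>\<alpha>\<in>UNIV. c $ \<alpha> *\<^sub>R e \<alpha>) $ j $ b = c $ (j, b)" for c :: "real ^ ('n \<times> 'd)" and j b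
  proof -
    have "(\<Sum>\<alpha>\<in>UNIV. c $ \<alpha> *\<^sub>R e \<alpha>) $ j $ b = (\<Sum>\<alpha>\<in>UNIV. if \<alpha> = (j, b) then c $ (j, b) else 0)"
      unfolding sum_component
      by (rule sum.cong) (auto simp: e_def axis_def split: prod.split)
    then show ?thesis by simp
  qed
  have g_iff: "g y \<noteq> 0 \<longleftrightarrow> (\<forall>v. f' y v = 0 \<and> (\<forall>b\<in>D. v \<bullet> b = 0) \<longrightarrow> v = 0)" (is "_ \<longleftrightarrow> ?R") for y
  proof
    assume "g y \<noteq> 0"
    then have *: "c = 0" if "(\<Sum>\<alpha>\<in>UNIV. c $ \<alpha> *\<^sub>R u y \<alpha>) = 0" for c
      using that unfolding g_def det_gram_nonzero_iff by blast
    show ?R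
    proof (intro allI impI)
      fix v assume v: "f' y v = 0 \<and> (\<forall>b\<in>D. v \<bullet> b = 0)"
      let ?c = "\<chi> \<alpha>. v $ fst \<alpha> $ snd \<alpha>"
      have "(\<Sum>\<alpha>\<in>UNIV. ?c $ \<alpha> *\<^sub>R u y \<alpha>) = (f' y v, \<pi> v)"
        unfolding u_sum by (simp flip: expand)
      also have "\<dots> = 0" using v pi0 by (simp add: zero_prod_def)
      finally have "?c = 0" by (rule *)
      then show "v = 0" by (simp add: vec_eq_iff)
    qed
  next
    assume R: ?R
    show "g y \<noteq> 0"
      unfolding g_def det_gram_nonzero_iff u_sum
    proof (intro allI impI)
      fix c :: "real ^ ('n \<times> 'd)"
      let ?v = "\<Sum>\<alpha>\<in>UNIV. c $ \<alpha> *\<^sub>R e \<alpha>"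
      assume "(f' y ?v, \<pi> ?v) = 0"
      then have "?v = 0" using R pi0 by (simp add: zero_prod_def)
      then show "c = 0" using comb[of c] by (simp add: vec_eq_iff)
    qed
  qed
  \<comment> \<open>The choice of \<open>D\<close> makes \<open>g\<close> nonzero at
    \<open>x\<close>; genericity carries this to \<open>p\<close>, and continuity to a neighborhood
    of \<open>p\<close>.\<close>
  have "g x \<noteq> 0" using sep g_iff by blast
  then have "g p \<noteq> 0" using generic_int_poly_fun_nonzero[OF p gpoly] by blast
  then have "\<forall>\<^sub>F y in nhds p. g y \<noteq> 0"
    using continuous_int_poly_fun[OF gpoly, of p]
    by (intro tendsto_imp_eventually_ne[of g "g p"]) (simp_all add: isCont_def tendsto_at_iff_tendsto_nhds)
  then show ?thesis
  proof eventually_elim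
    case (elim y)
    then have "dim {v. f' y v = 0} \<le> card D"
      using g_iff[of y] by (intro dim_le_card_separating_coordinates sub D) auto
    then show ?case by (simp add: D)
  qed
qed

text \<open>Comparison with \<open>x = p\<close> bounds the dimension near \<open>p\<close> from
  above. Since the comparison point is arbitrary, the dimension at \<open>p\<close> is also the
  least of all, which gives the lower bound.\<close>

corollary generic_kernel_dim_const:
  fixes f' :: "real ^ 'd::finite ^ 'n::finite \<Rightarrow> (real ^ 'd ^ 'n) \<Rightarrow>\<^sub>L 'b::euclidean_space"
  assumes p: "generic_configuration p"
    and poly: "\<And>i a j b. int_poly_fun (\<lambda>x. f' x (axis i (axis a 1)) \<bullet> f' x (axis j (axis b 1)))"
  shows "\<forall>\<^sub>F y in nhds p. dim {v. f' y v = 0} = dim {v. f' p v = 0}"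
proof -
  have "dim {v. f' p v = 0} \<le> dim {v. f' x v = 0}" for x
    using generic_kernel_dim_le[of p f' x, OF p poly] by (rule eventually_nhds_x_imp_x)
  then show ?thesis
    by (intro eventually_mono[OF generic_kernel_dim_le[of p f' p, OF p poly]] antisym)
qed

section \<open>Level sets of maps of constant rank\<close>

text \<open>
  A form of the constant rank theorem. The chart is \<open>\<Phi> = (f' p)\<^sup>T \<circ> f + \<pi>\<close> with \<open>\<pi>\<close> a projection
  onto \<open>ker (f' p)\<close>; its derivative is invertible at \<open>p\<close> because the two summands have
  complementary ranges. \<open>G\<close> is the local inverse of \<open>\<Phi>\<close>: it carries the slices parallel to
  \<open>ker (f' p)\<close> into the level sets of \<open>f\<close>.
\<close>

lemma kernel_straightening:
  fixes f :: "'a::euclidean_space \<Rightarrow> 'b::euclidean_space" and f' :: "'a \<Rightarrow> 'a \<Rightarrow>\<^sub>L 'b"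
  assumes der: "\<And>x. (f has_derivative blinfun_apply (f' x)) (at x)"
    and cont: "continuous_on UNIV f'"
    and const: "\<forall>\<^sub>F x in nhds p. dim {v. f' x v = 0} = dim {v. f' p v = 0}"
    and W: "open W" "p \<in> W"
  obtains \<Phi> G G' e U where
    "e > 0" "open U" "p \<in> U" "G (\<Phi> p) = p"
    "\<forall>x\<in>U. \<Phi> x \<in> ball (\<Phi> p) e \<and> G (\<Phi> x) = x"
    "\<forall>x. f x = f p \<longrightarrow> f' p (\<Phi> x - \<Phi> p) = 0"
    "\<forall>y\<in>ball (\<Phi> p) e. G y \<in> W"
    "\<forall>y\<in>ball (\<Phi> p) e. (G has_derivative G' y) (at y)"
    "\<forall>y\<in>ball (\<Phi> p) e. \<forall>w. f' p w = 0 \<longrightarrow> f' (G y) (G' y w) = 0"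
    "\<forall>w. f' p w = 0 \<longrightarrow> G' (\<Phi> p) w = w"
proof -
  define S where "S = {v. f' p v = 0}"
  have subker: "subspace {v. f' x v = 0}" for x
    by (auto simp: subspace_def blinfun.bilinear_simps)
  then have subS: "subspace S" by (simp add: S_def)
  \<comment> \<open>A linear left inverse of the identity on \<open>S\<close> with range in
    \<open>S\<close> is a projection onto \<open>S\<close>.\<close>
  obtain \<pi>0 where \<pi>0: "range \<pi>0 \<subseteq> S" "linear \<pi>0" "\<And>v. v \<in> S \<Longrightarrow> \<pi>0 v = v"
    using linear_exists_left_inverse_on[OF linear_id subS] by (auto simp: inj_on_def)
  define A where "A = Blinfun (adjoint (f' p))"
  define \<pi> where "\<pi> = Blinfun \<pi>0"
  have linf: "linear (blinfun_apply (f' x))" for x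
    by (simp add: blinfun.bounded_linear_right linear_conv_bounded_linear)
  have A: "blinfun_apply A = adjoint (f' p)"
    unfolding A_def by (intro bounded_linear_Blinfun_apply linear_linear[THEN iffD2] adjoint_linear linf)
  have \<pi>: "blinfun_apply \<pi> = \<pi>0"
    unfolding \<pi>_def by (intro bounded_linear_Blinfun_apply linear_linear[THEN iffD2] \<pi>0)
  have \<pi>S: "\<pi> v \<in> S" for v using \<pi>0(1) \<pi> by auto
  have \<pi>id: "\<pi> v = v" if "v \<in> S" for v using \<pi>0(3) \<pi> that by simp
  have orth: "s \<bullet> A w = 0" if "s \<in> S" for s w
    using that by (simp add: A adjoint_works[OF linf] S_def)
  have split0: "A w = 0 \<and> s = 0" if "A w + s = 0" "s \<in> S" for w s
  proof -
    have "s \<bullet> s = s \<bullet> (A w + s)" using orth[OF that(2)] by (simp add: inner_add_right)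
    then show ?thesis using that by simp
  qed
  define \<Phi> where "\<Phi> x = A (f x) + \<pi> x" for x
  define \<Phi>' where "\<Phi>' x = (A o\<^sub>L f' x) + \<pi>" for x
  have \<Phi>'app: "\<Phi>' x v = A (f' x v) + \<pi> v" for x v
    by (simp add: \<Phi>'_def blinfun.bilinear_simps)
  have der\<Phi>: "(\<Phi> has_derivative blinfun_apply (\<Phi>' x)) (at x)" for x
    unfolding \<Phi>_def \<Phi>'app[abs_def]
    by (auto intro!: derivative_eq_intros der simp: fun_eq_iff \<Phi>'app)
  have cont\<Phi>: "continuous_on UNIV \<Phi>'"
    unfolding \<Phi>'_def by (intro continuous_intros cont)
  have inj: "v = 0" if "\<Phi>' p v = 0" for v
  proof -
    from that have v: "A (f' p v) = 0" "\<pi> v = 0"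
      using split0[OF _ \<pi>S] by (auto simp: \<Phi>'app)
    \<comment> \<open>By adjointness \<open>A\<close> is injective on the range of
      \<open>f' p\<close>.\<close>
    have "f' p v \<bullet> f' p v = v \<bullet> A (f' p v)" by (simp add: A adjoint_works[OF linf])
    then have "v \<in> S" using v by (simp add: S_def)
    then show ?thesis using v \<pi>id by simp
  qed
  have lin\<Phi>: "linear (blinfun_apply (\<Phi>' p))"
    by (simp add: blinfun.bounded_linear_right linear_conv_bounded_linear)
  then obtain h where h: "linear h" "h \<circ> \<Phi>' p = id"
    using linear_injective_left_inverse linear_injective_0 inj by metis
  have "blinfun_apply (Blinfun h) = h"
    by (intro bounded_linear_Blinfun_apply linear_linear[THEN iffD2] h)
  then have inv: "Blinfun h o\<^sub>L \<Phi>' p = id_blinfun"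
    using h(2) by (intro blinfun_eqI) (simp add: fun_eq_iff)
  \<comment> \<open>The local inverse takes its values in the domain given to the inverse function
    theorem, so shrinking that domain first ensures both \<open>G y \<in> W\<close> and constant
    kernel dimension at the points \<open>G y\<close>.\<close>
  have "\<exists>W'. open W' \<and> p \<in> W' \<and> W' \<subseteq> W \<and> (\<forall>x\<in>W'. dim {v. f' x v = 0} = dim S)"
  proof -
    obtain W0 where "open W0" "p \<in> W0" "\<And>x. x \<in> W0 \<Longrightarrow> dim {v. f' x v = 0} = dim S"
      using const unfolding eventually_nhds S_def by blast
    then show ?thesis using W by (intro exI[of _ "W \<inter> W0"]) auto
  qed
  then obtain W' where W': "open W'" "p \<in> W'" "W' \<subseteq> W"
    and dimW': "\<And>x. x \<in> W' \<Longrightarrow> dim {v. f' x v = 0} = dim S" by blast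
  obtain U V G G' where UV: "open U" "U \<subseteq> W'" "p \<in> U" "open V" "\<Phi> p \<in> V" "homeomorphism U V \<Phi> G"
    and G: "\<And>y. y \<in> V \<Longrightarrow> (G has_derivative G' y) (at y)"
    and G': "\<And>y. y \<in> V \<Longrightarrow> G' y = inv (blinfun_apply (\<Phi>' (G y)))"
    and bij: "\<And>y. y \<in> V \<Longrightarrow> bij (blinfun_apply (\<Phi>' (G y)))"
    using inverse_function_theorem[OF W'(1) der\<Phi> continuous_on_subset[OF cont\<Phi>] W'(2) inv] by blast
  \<comment> \<open>A ball is taken inside \<open>V\<close> so that \<open>segment_in_ball\<close>
    applies to it.\<close>
  obtain e where e: "e > 0" "ball (\<Phi> p) e \<subseteq> V" using UV open_contains_ball by blast
  define U' where "U' = U \<inter> \<Phi> -` ball (\<Phi> p) e"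
  have GW: "G y \<in> W'" if "y \<in> V" for y
    using that UV by (auto simp: homeomorphism_def)
  have \<Phi>G: "\<Phi>' (G y) (G' y w) = w" if "y \<in> V" for y w
    using G'[OF that] bij[OF that] by (simp add: bij_is_surj surj_f_inv_f)
  show ?thesis
  proof (rule that[of e U' G \<Phi> G'])
    show "e > 0" by fact
    show "open U'"
      unfolding U'_def using UV(1) has_derivative_continuous[OF der\<Phi>]
      by (intro open_Int open_vimage open_ball continuous_at_imp_continuous_on ballI)
    show "p \<in> U'" using UV e by (simp add: U'_def)
    show "G (\<Phi> p) = p" using UV by (auto simp: homeomorphism_def)
    show "\<forall>x\<in>U'. \<Phi> x \<in> ball (\<Phi> p) e \<and> G (\<Phi> x) = x"
      using UV by (auto simp: homeomorphism_def U'_def)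
    show "\<forall>x. f x = f p \<longrightarrow> f' p (\<Phi> x - \<Phi> p) = 0"
    proof (intro allI impI)
      fix x assume "f x = f p"
      \<comment> \<open>The \<open>A\<close> terms cancel, leaving a vector in the range of
        \<open>\<pi>\<close>, which is \<open>S\<close>.\<close>
      then have "\<Phi> x - \<Phi> p = \<pi> (x - p)" by (simp add: \<Phi>_def blinfun.diff_right)
      then show "f' p (\<Phi> x - \<Phi> p) = 0" using \<pi>S by (simp add: S_def)
    qed
    show "\<forall>y\<in>ball (\<Phi> p) e. G y \<in> W" using GW W' e by blast
    show "\<forall>y\<in>ball (\<Phi> p) e. (G has_derivative G' y) (at y)" using G e by blast
    show "\<forall>y\<in>ball (\<Phi> p) e. \<forall>w. f' p w = 0 \<longrightarrow> f' (G y) (G' y w) = 0"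
    proof (intro ballI allI impI)
      fix y w assume "y \<in> ball (\<Phi> p) e"
      then have y: "y \<in> V" using e by blast
      assume w: "f' p w = 0"
      \<comment> \<open>This is where constant rank enters. As \<open>\<Phi>' (G y)\<close> is
        injective, \<open>\<pi>\<close> is injective on \<open>?M\<close>, so
        \<open>dim ?M \<le> dim S = dim ?N\<close>, and the evident inclusion of \<open>?N\<close>
        in \<open>?M\<close> is an equality.\<close>
      let ?N = "{v. f' (G y) v = 0}" and ?M = "{v. A (f' (G y) v) = 0}"
      have subM: "subspace ?M"
        by (auto simp: subspace_def blinfun.bilinear_simps)
      have lin\<pi>: "linear (blinfun_apply \<pi>)" using \<pi> \<pi>0 by simp
      have "v = 0" if "v \<in> ?M" "\<pi> v = 0" for v
      proof -
        have "\<Phi>' (G y) v = \<Phi>' (G y) 0" using that by (simp add: \<Phi>'app blinfun.zero_right)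
        then show ?thesis using bij[OF y] by (metis bij_is_inj injD)
      qed
      then have "inj_on (blinfun_apply \<pi>) (span ?M)"
        unfolding span_eq_iff[THEN iffD2, OF subM] linear_inj_on_iff_eq_0[OF lin\<pi> subM] by blast
      then have "dim ?M = dim (\<pi> ` ?M)" using dim_image_eq[OF lin\<pi>] by metis
      also have "\<dots> \<le> dim S" by (rule dim_subset) (use \<pi>S in auto)
      also have "\<dots> = dim ?N" using dimW'[OF GW[OF y]] by simp
      finally have NM: "?N = ?M"
        by (intro subspace_dim_equal[OF subker subM]) (auto simp: blinfun.zero_right)
      \<comment> \<open>Because \<open>w\<close> lies in \<open>S\<close>, the equation
        \<open>\<Phi>' (G y) (G' y w) = w\<close> splits into a part in the range of
        \<open>A\<close> and a part in \<open>S\<close>; these subspaces are orthogonal, so the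
        first part vanishes.\<close>
      have "A (f' (G y) (G' y w)) + (\<pi> (G' y w) - w) = 0"
        using \<Phi>G[OF y, of w] by (simp add: \<Phi>'app algebra_simps)
      moreover have "\<pi> (G' y w) - w \<in> S"
        using \<pi>S w subS by (intro subspace_diff) (auto simp: S_def)
      ultimately show "f' (G y) (G' y w) = 0" using split0 NM by blast
    qed
    show "\<forall>w. f' p w = 0 \<longrightarrow> G' (\<Phi> p) w = w"
    proof (intro allI impI)
      fix w assume w: "f' p w = 0"
      have Gp: "G (\<Phi> p) = p" using UV by (auto simp: homeomorphism_def)
      \<comment> \<open>On \<open>S\<close> the derivative \<open>\<Phi>' p\<close> is the identity,
        since \<open>f' p\<close> vanishes there and \<open>\<pi>\<close> fixes
        \<open>S\<close>.\<close>
      have "\<Phi>' p (G' (\<Phi> p) w) = \<Phi>' p w"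
        using \<Phi>G[OF UV(5), of w] Gp w \<pi>id by (simp add: \<Phi>'app S_def blinfun.zero_right)
      then show "G' (\<Phi> p) w = w" using bij[OF UV(5)] Gp by (metis bij_is_inj injD)
    qed
  qed
qed

lemma segment_in_ball:
  fixes a b :: "'a::real_normed_vector"
  assumes "b \<in> ball a e" "t \<in> {0..1}"
  shows "a + t *\<^sub>R (b - a) \<in> ball a e"
proof -
  have "norm (t *\<^sub>R (b - a)) \<le> norm (b - a)"
    using assms(2) by (simp add: mult_left_le_one_le)
  then show ?thesis using assms(1) by (simp add: dist_norm norm_minus_commute)
qed

text \<open>A point \<open>q\<close> near \<open>p\<close> on its level set is joined to
  \<open>p\<close> by the image under \<open>G\<close> of the segment from \<open>\<Phi> p\<close>
  to \<open>\<Phi> q\<close>. The segment is parallel to the kernel of \<open>f' p\<close>, so the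
  velocity of the curve lies in the kernels of \<open>f'\<close> and hence of \<open>k'\<close>, and
  \<open>k\<close> is constant along it.\<close>

lemma level_set_constant_if_kernel_subset:
  fixes f :: "'a::euclidean_space \<Rightarrow> 'b::euclidean_space" and f' :: "'a \<Rightarrow> 'a \<Rightarrow>\<^sub>L 'b"
    and k :: "'a \<Rightarrow> 'c::euclidean_space"
  assumes der: "\<And>x. (f has_derivative blinfun_apply (f' x)) (at x)"
    and cont: "continuous_on UNIV f'"
    and const: "\<forall>\<^sub>F x in nhds p. dim {v. f' x v = 0} = dim {v. f' p v = 0}"
    and derk: "\<And>x. (k has_derivative k' x) (at x)"
    and sub: "\<forall>\<^sub>F x in nhds p. \<forall>v. f' x v = 0 \<longrightarrow> k' x v = 0"
  shows "\<forall>\<^sub>F q in nhds p. f q = f p \<longrightarrow> k q = k p"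
proof -
  obtain W where W: "open W" "p \<in> W" and ker: "\<And>x v. x \<in> W \<Longrightarrow> f' x v = 0 \<Longrightarrow> k' x v = 0"
    using sub unfolding eventually_nhds by blast
  obtain \<Phi> G G' e U where e: "e > 0" and U: "open U" "p \<in> U" and Gp: "G (\<Phi> p) = p"
    and GU: "\<forall>x\<in>U. \<Phi> x \<in> ball (\<Phi> p) e \<and> G (\<Phi> x) = x"
    and \<Phi>: "\<forall>x. f x = f p \<longrightarrow> f' p (\<Phi> x - \<Phi> p) = 0"
    and GW: "\<forall>y\<in>ball (\<Phi> p) e. G y \<in> W"
    and G: "\<forall>y\<in>ball (\<Phi> p) e. (G has_derivative G' y) (at y)"
    and G': "\<forall>y\<in>ball (\<Phi> p) e. \<forall>w. f' p w = 0 \<longrightarrow> f' (G y) (G' y w) = 0"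
    and Gpv: "\<forall>w. f' p w = 0 \<longrightarrow> G' (\<Phi> p) w = w"
    by (rule kernel_straightening[OF der cont const W]) (rule that)
  have "k q = k p" if q: "q \<in> U" "f q = f p" for q
  proof -
    define y where "y t = \<Phi> p + t *\<^sub>R (\<Phi> q - \<Phi> p)" for t :: real
    have yball: "y t \<in> ball (\<Phi> p) e" if "t \<in> {0..1}" for t
      unfolding y_def using segment_in_ball GU q that by blast
    have "((\<lambda>t. k (G (y t))) has_derivative (\<lambda>h. 0)) (at t within {0..1})" if t: "t \<in> {0..1}" for t
    proof -
      have "(y has_derivative (\<lambda>h. h *\<^sub>R (\<Phi> q - \<Phi> p))) (at t)"
        unfolding y_def by (auto intro!: derivative_eq_intros)
      from has_derivative_compose[OF has_derivative_compose[OF this bspec[OF G yball[OF t]]] derk]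
      have "((\<lambda>t. k (G (y t))) has_derivative
          (\<lambda>h. k' (G (y t)) (G' (y t) (h *\<^sub>R (\<Phi> q - \<Phi> p))))) (at t)" .
      moreover have "k' (G (y t)) (G' (y t) (h *\<^sub>R (\<Phi> q - \<Phi> p))) = 0" for h
        using yball[OF t] \<Phi> q(2)
        by (intro ker GW[rule_format] G'[rule_format]) (simp_all add: blinfun.scaleR_right)
      ultimately show ?thesis by (simp add: has_derivative_at_withinI)
    qed
    then have "\<exists>c. \<forall>t\<in>{0..1}. k (G (y t)) = c"
      by (intro has_derivative_zero_constant) auto
    then have "k (G (y 1)) = k (G (y 0))" by (metis atLeastAtMost_iff order_refl zero_le_one)
    then show ?thesis using Gp GU q by (simp add: y_def)
  qed
  then show ?thesis using U unfolding eventually_nhds by blast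
qed

text \<open>Here the curve \<open>G (\<Phi> p + t v)\<close> starts at \<open>p\<close> with
  velocity \<open>v\<close> and stays in the level set of \<open>f\<close> for small
  \<open>t\<close>. So \<open>k\<close> is constant along it, and its derivative in direction
  \<open>v\<close> is zero.\<close>

lemma kernel_subset_if_level_set_constant:
  fixes f :: "'a::euclidean_space \<Rightarrow> 'b::euclidean_space" and f' :: "'a \<Rightarrow> 'a \<Rightarrow>\<^sub>L 'b"
    and k :: "'a \<Rightarrow> 'c::euclidean_space"
  assumes der: "\<And>x. (f has_derivative blinfun_apply (f' x)) (at x)"
    and cont: "continuous_on UNIV f'"
    and const: "\<forall>\<^sub>F x in nhds p. dim {v. f' x v = 0} = dim {v. f' p v = 0}"
    and derk: "(k has_derivative k') (at p)"
    and level: "\<forall>\<^sub>F q in nhds p. f q = f p \<longrightarrow> k q = k p"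
    and v: "f' p v = 0"
  shows "k' v = 0"
proof -
  obtain W where W: "open W" "p \<in> W" and kW: "\<And>x. x \<in> W \<Longrightarrow> f x = f p \<Longrightarrow> k x = k p"
    using level unfolding eventually_nhds by blast
  obtain \<Phi> G G' e U where e: "e > 0" and U: "open U" "p \<in> U" and Gp: "G (\<Phi> p) = p"
    and GU: "\<forall>x\<in>U. \<Phi> x \<in> ball (\<Phi> p) e \<and> G (\<Phi> x) = x"
    and \<Phi>: "\<forall>x. f x = f p \<longrightarrow> f' p (\<Phi> x - \<Phi> p) = 0"
    and GW: "\<forall>y\<in>ball (\<Phi> p) e. G y \<in> W"
    and G: "\<forall>y\<in>ball (\<Phi> p) e. (G has_derivative G' y) (at y)"
    and G': "\<forall>y\<in>ball (\<Phi> p) e. \<forall>w. f' p w = 0 \<longrightarrow> f' (G y) (G' y w) = 0"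
    and Gpv: "\<forall>w. f' p w = 0 \<longrightarrow> G' (\<Phi> p) w = w"
    by (rule kernel_straightening[OF der cont const W]) (rule that)
  define y where "y t = \<Phi> p + t *\<^sub>R v" for t :: real
  have dery: "(y has_derivative (\<lambda>h. h *\<^sub>R v)) (at t)" for t
    unfolding y_def by (auto intro!: derivative_eq_intros)
  define I where "I = y -` ball (\<Phi> p) e"
  have openI: "open I"
    unfolding I_def y_def by (intro open_vimage open_ball continuous_intros)
  have I0: "0 \<in> I" using e by (simp add: I_def y_def)
  obtain r where r: "r > 0" "ball 0 r \<subseteq> I" using openI I0 open_contains_ball by blast
  have "((\<lambda>t. f (G (y t))) has_derivative (\<lambda>h. 0)) (at t within ball 0 r)" if t: "t \<in> ball 0 r" for t
  proof -
    have yt: "y t \<in> ball (\<Phi> p) e" using t r by (auto simp: I_def)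
    from has_derivative_compose[OF has_derivative_compose[OF dery bspec[OF G yt]] der]
    have "((\<lambda>t. f (G (y t))) has_derivative (\<lambda>h. f' (G (y t)) (G' (y t) (h *\<^sub>R v)))) (at t)" .
    moreover have "f' (G (y t)) (G' (y t) (h *\<^sub>R v)) = 0" for h
      using yt v by (intro G'[rule_format]) (simp_all add: blinfun.scaleR_right)
    ultimately show ?thesis by (simp add: has_derivative_at_withinI)
  qed
  then have "\<exists>c. \<forall>t\<in>ball 0 r. f (G (y t)) = c"
    by (intro has_derivative_zero_constant) auto
  moreover have y0: "G (y 0) = p" using Gp by (simp add: y_def)
  ultimately have "f (G (y t)) = f p" if "t \<in> ball 0 r" for t
    using that r(1) by (metis centre_in_ball)
  then have const: "k (G (y t)) = k p" if "t \<in> ball 0 r" for t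
    using that r by (intro kW GW[rule_format]) (auto simp: I_def)
  have "(k has_derivative k') (at (G (y 0)))" using derk y0 by simp
  moreover have "y 0 \<in> ball (\<Phi> p) e" using I0 by (simp add: I_def)
  ultimately have "((\<lambda>t. k (G (y t))) has_derivative (\<lambda>h. k' (G' (y 0) (h *\<^sub>R v)))) (at 0)"
    using has_derivative_compose[OF has_derivative_compose[OF dery bspec[OF G]]] by blast
  \<comment> \<open>The chain rule and the local constancy of \<open>k\<close> along the curve give
    two derivatives at 0, which must agree.\<close>
  moreover have "((\<lambda>t. k (G (y t))) has_derivative (\<lambda>h. 0)) (at 0)"
    using const r(1) by (intro has_derivative_transform_within_open[OF has_derivative_const, of "ball 0 r"]) auto
  ultimately have "(\<lambda>h. k' (G' (y 0) (h *\<^sub>R v))) = (\<lambda>h. 0)"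
    by (rule has_derivative_unique)
  from fun_cong[OF this, of 1] show ?thesis using Gpv v by (simp add: y_def)
qed

section \<open>The angle map\<close>

text \<open>The polarized, bilinear form yields the derivative of its diagonal by the product rule.
  Padding with zeros outside \<open>T\<close> gives all sets of triples the same codomain.\<close>

definition angle_form ::
    "('n \<times> 'n \<times> 'n) set \<Rightarrow> real ^ 'd::finite ^ 'n::finite \<Rightarrow> real ^ 'd ^ 'n \<Rightarrow> real ^ ('n \<times> 'n \<times> 'n)" where
  "angle_form T x y = (\<chi> t. case t of (i, j, k) \<Rightarrow>
     if t \<in> T then (x $ i - x $ j) \<bullet> (y $ i - y $ k) else 0)"

lemma angle_form_nth:
  "angle_form T x y $ (i, j, k) = (if (i, j, k) \<in> T then (x $ i - x $ j) \<bullet> (y $ i - y $ k) else 0)"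
  by (simp add: angle_form_def)

lemma bounded_bilinear_angle_form: "bounded_bilinear (angle_form T)"
  unfolding bilinear_conv_bounded_bilinear[symmetric] bilinear_def
  by (auto intro!: linearI simp: vec_eq_iff angle_form_nth inner_simps algebra_simps)

lemma weakly_equivalent_iff: "weakly_equivalent T p q \<longleftrightarrow> angle_form T q q = angle_form T p p"
  by (auto simp: weakly_equivalent_def vec_eq_iff angle_form_nth)

lemma weakly_congruent_iff: "weakly_congruent p q \<longleftrightarrow> angle_form UNIV q q = angle_form UNIV p p"
  by (auto simp: weakly_congruent_def vec_eq_iff angle_form_nth)

text \<open>Equivalence for the full set of triples implies equivalence for every subset, so if some
  subset witnesses rigidity, the full set does too.\<close>

lemma weakly_rigid_iff:
  "weakly_rigid E p \<longleftrightarrow> (\<forall>\<^sub>F q in nhds p.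
     angle_form (angle_triples E) q q = angle_form (angle_triples E) p p \<longrightarrow>
     angle_form UNIV q q = angle_form UNIV p p)"
proof -
  have "weakly_rigid E p \<longleftrightarrow> (\<exists>U. open U \<and> p \<in> U \<and>
      (\<forall>q\<in>U. weakly_equivalent (angle_triples E) p q \<longrightarrow> weakly_congruent p q))"
  proof
    assume "weakly_rigid E p"
    then obtain T U where T: "T \<subseteq> angle_triples E" and U: "open U" "p \<in> U"
      and rigid: "\<forall>q\<in>U. weakly_equivalent T p q \<longrightarrow> weakly_congruent p q"
      unfolding weakly_rigid_def by blast
    have "weakly_equivalent T p q" if "weakly_equivalent (angle_triples E) p q" for q
      using that T by (auto simp: weakly_equivalent_def)
    then show "\<exists>U. open U \<and> p \<in> U \<and>
        (\<forall>q\<in>U. weakly_equivalent (angle_triples E) p q \<longrightarrow> weakly_congruent p q)"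
      using U rigid by blast
  qed (auto simp: weakly_rigid_def)
  then show ?thesis
    unfolding eventually_nhds weakly_equivalent_iff weakly_congruent_iff .
qed

definition angle_deriv ::
    "('n \<times> 'n \<times> 'n) set \<Rightarrow> real ^ 'd::finite ^ 'n::finite \<Rightarrow> (real ^ 'd ^ 'n) \<Rightarrow>\<^sub>L (real ^ ('n \<times> 'n \<times> 'n))" where
  "angle_deriv T x = Blinfun (\<lambda>v. angle_form T x v + angle_form T v x)"

lemma angle_deriv_apply: "angle_deriv T x v = angle_form T x v + angle_form T v x"
proof -
  interpret bounded_bilinear "angle_form T" by (rule bounded_bilinear_angle_form)
  show ?thesis
    unfolding angle_deriv_def
    by (subst bounded_linear_Blinfun_apply)
      (auto intro: bounded_linear_add bounded_linear_left bounded_linear_right)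
qed

lemma has_derivative_angle_form:
  "((\<lambda>q. angle_form T q q) has_derivative blinfun_apply (angle_deriv T x)) (at x)"
  unfolding angle_deriv_apply[abs_def]
  by (rule bounded_bilinear.FDERIV[OF bounded_bilinear_angle_form]) (rule has_derivative_ident)+

lemma continuous_on_angle_deriv: "continuous_on S (angle_deriv T)"
proof -
  have "linear (angle_deriv T)"
    by (intro linearI blinfun_eqI)
      (auto simp: angle_deriv_apply blinfun.bilinear_simps algebra_simps
        bounded_bilinear.add_left[OF bounded_bilinear_angle_form]
        bounded_bilinear.add_right[OF bounded_bilinear_angle_form]
        bounded_bilinear.scaleR_left[OF bounded_bilinear_angle_form]
        bounded_bilinear.scaleR_right[OF bounded_bilinear_angle_form])
  then show ?thesis
    unfolding linear_conv_bounded_linear by (rule linear_continuous_on)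
qed

text \<open>Each entry of the derivative along a standard basis vector is linear in \<open>x\<close>
  with integer coefficients, as the coordinates of that vector are 0 or 1.\<close>

lemma int_poly_fun_angle_deriv:
  fixes i j :: "'n::finite" and a b :: "'d::finite"
  shows "int_poly_fun (\<lambda>x. angle_deriv T x (axis i (axis a 1)) \<bullet> angle_deriv T x (axis j (axis b 1)))"
proof -
  have e: "(axis i (axis a 1) :: real ^ 'd ^ 'n) $ l $ c = of_int (if l = i \<and> c = a then 1 else 0)" for i a l c
    by (simp add: axis_def)
  have "int_poly_fun (\<lambda>x. angle_deriv T x (axis i (axis a 1)) $ t)" for i :: 'n and a :: 'd and t
  proof (cases t)
    case (fields l m k)
    show ?thesis
    proof (cases "t \<in> T")
      case True
      then have "(\<lambda>x. angle_deriv T x (axis i (axis a 1)) $ t) =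
        (\<lambda>x. (\<Sum>c\<in>UNIV. (x $ l $ c - x $ m $ c) *
              (axis i (axis a 1) $ l $ c - axis i (axis a 1) $ k $ c)) +
            (\<Sum>c\<in>UNIV. (axis i (axis a 1) $ l $ c - axis i (axis a 1) $ m $ c) *
              (x $ l $ c - x $ k $ c)))"
        by (simp add: fields angle_deriv_apply angle_form_nth inner_vec_def)
      then show ?thesis
        unfolding e by (simp only:) (intro int_poly_fun_add int_poly_fun_sum int_poly_fun_mult
          int_poly_fun_diff int_poly_fun_coord int_poly_fun_const)
    next
      case False
      then show ?thesis
        using int_poly_fun_const[of 0] by (simp add: fields angle_deriv_apply angle_form_nth)
    qed
  qed
  then show ?thesis
    unfolding inner_vec_def inner_real_def by (intro int_poly_fun_sum int_poly_fun_mult)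
qed

lemma angle_deriv_kernel_mono:
  assumes "angle_deriv UNIV x v = 0"
  shows "angle_deriv T x v = 0"
  using assms by (auto simp: angle_deriv_apply vec_eq_iff angle_form_nth split: if_splits)

section \<open>Transfer of rigidity between generic configurations\<close>

lemma generic_angle_deriv_kernel_dim:
  fixes p q :: "real ^ 'd::finite ^ 'n::finite"
  assumes "generic_configuration p" "generic_configuration q"
  shows "dim {v. angle_deriv T p v = 0} = dim {v. angle_deriv T q v = 0}"
  using generic_kernel_dim_le[OF assms(1) int_poly_fun_angle_deriv, THEN eventually_nhds_x_imp_x]
    generic_kernel_dim_le[OF assms(2) int_poly_fun_angle_deriv, THEN eventually_nhds_x_imp_x]
  by (rule antisym)

theorem theorem3p18:
  fixes E :: "('n::{finite,linorder} \<times> 'n) set"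
    and p :: "real ^ 'd::finite ^ 'n::{finite,linorder}"
  assumes "simple_graph E"
    and "CARD('n) \<ge> CARD('d) + 1"
    and "generic_configuration p"
    and "weakly_rigid E p"
  shows "generically_weakly_rigid TYPE('d) E"
  unfolding generically_weakly_rigid_def
proof (intro allI impI)
  fix q :: "real ^ 'd ^ 'n::{finite,linorder}"
  assume q: "generic_configuration q"
  let ?T = "angle_triples E"
  let ?N = "\<lambda>T x. {v :: real ^ 'd ^ 'n::{finite,linorder}. angle_deriv T x v = 0}"
  note const = generic_kernel_dim_const[OF _ int_poly_fun_angle_deriv]
  have sub: "subspace (?N T x)" for T x
    by (auto simp: subspace_def blinfun.bilinear_simps)
  have mono: "?N UNIV x \<subseteq> ?N ?T x" for x
    using angle_deriv_kernel_mono by blast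
  \<comment> \<open>Rigidity at \<open>p\<close> says that the full angle map is constant on the
    level set of the graph's angle map near \<open>p\<close>.\<close>
  have "?N ?T p \<subseteq> ?N UNIV p"
    using kernel_subset_if_level_set_constant[OF has_derivative_angle_form continuous_on_angle_deriv
        const[OF assms(3)] has_derivative_angle_form assms(4)[unfolded weakly_rigid_iff]] by blast
  then have "?N ?T p = ?N UNIV p" using mono by blast
  then have dimq: "dim (?N ?T q) = dim (?N UNIV q)"
    using generic_angle_deriv_kernel_dim[OF assms(3) q] by metis
  \<comment> \<open>Equal kernels are needed at all points near \<open>q\<close>, as
    \<open>k\<close> is followed along curves. Both kernel dimensions are constant near
    \<open>q\<close> and agree at \<open>q\<close>, so the inclusion \<open>mono\<close> becomes an
    equality nearby.\<close>
  have "\<forall>\<^sub>F x in nhds q. \<forall>v. angle_deriv ?T x v = 0 \<longrightarrow> angle_deriv UNIV x v = 0"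
    using const[OF q, of ?T] const[OF q, of UNIV]
  proof eventually_elim
    case (elim x)
    then have "?N UNIV x = ?N ?T x"
      using dimq by (intro subspace_dim_equal[OF sub sub mono]) simp
    then show ?case by blast
  qed
  then show "weakly_rigid E q"
    unfolding weakly_rigid_iff
    by (rule level_set_constant_if_kernel_subset[OF has_derivative_angle_form continuous_on_angle_deriv
          const[OF q] has_derivative_angle_form])
qed

end
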